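(* Consider the one-stage game with $n\ge2$ sources, slot lengths $\sigma_I,\sigma_S,\sigma_C$ (with any ordering of $\sigma_S$ and $\sigma_C$) and age vector $(\Delta_{1,t},\dots,\Delta_{n,t})$. Let $\mathbf p^*=(p_1,\dots,p_n,p_I,p_C)$ be a one-stage optimal strategy, i.e. a solution of $$\max_{\mathbf p\in\mathcal P}\ \sum_{k=1}^n U_{k,t}(\mathbf p).$$ Then $p_C=0$. In addition, if $\Delta_{k,t}<n(\sigma_S-\sigma_I)$ for every source $k$, then $p_I=1$.
   Context: One-stage game. There are $n\ge2$ sources $\mathcal N=\{1,\dots,n\}$. Idle, successful-transmission and collision slots have real lengths $\sigma_I,\sigma_S,\sigma_C>0$, with $\sigma_I<\sigma_S$ and $\sigma_I<\sigma_C$. At the beginning of slot $t$ source $k$ has age $\Delta_{k,t}$, and it is assumed that $\Delta_{k,t}\ge\sigma_S$ for all $k$. Each source $k$ chooses an action $a_k\in\{\mathcal T,\mathcal I\}$ (transmit or idle). Given the action profile $a=(a_1,\dots,a_n)$, the next age of source $k$ is: $\Delta_{k,t+1}=\Delta_{k,t}+\sigma_I$ if no source transmits (event $I$); $\Delta_{k,t}+\sigma_C$ if at least two sources transmit (event $C$); $\Delta_{k,t}+\sigma_S$ if exactly one source transmits and it is not $k$ (event $S_{-k}$); $\sigma_S$ if $k$ is the only source that transmits (event $S_k$). The payoff of $k$ is $U_{k,t}(a)=-\Delta_{k,t+1}$. Minmax payoff (over pure actions): $v_{k,t}^*=\min_{a_{-k}\in\{\mathcal T,\mathcal I\}^{n-1}}\max_{a_k\in\{\mathcal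 T,\mathcal I\}}U_{k,t}(a_k,a_{-k})$. Correlated strategies: a probability vector is $\mathbf p=(p_1,\dots,p_n,p_I,p_C)$ with nonnegative entries summing to $1$, where $p_k$ is the probability of event $S_k$, $p_I$ that of event $I$ and $p_C$ that of event $C$. The resulting expected payoff of source $k$ is $$U_{k,t}(\mathbf p)=-\Big[p_k\sigma_S+\Big(\sum_{j\ne k}p_j\Big)(\Delta_{k,t}+\sigma_S)+p_I(\Delta_{k,t}+\sigma_I)+p_C(\Delta_{k,t}+\sigma_C)\Big].$$ The set of individually rational probability vectors is $\mathcal P=\{\mathbf p: U_{k,t}(\mathbf p)\ge v_{k,t}^*\ \text{for all } k\in\mathcal N\}$. *)

theory Defs
  imports Complex_Main "HOL-Library.FuncSet"
begin

datatype action = Transmit | Idle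

definition transmitters :: "nat \<Rightarrow> (nat \<Rightarrow> action) \<Rightarrow> nat set" where
  "transmitters n a = {j \<in> {1..n}. a j = Transmit}"

definition next_age ::
  "nat \<Rightarrow> real \<Rightarrow> real \<Rightarrow> real \<Rightarrow> (nat \<Rightarrow> real) \<Rightarrow> nat \<Rightarrow> (nat \<Rightarrow> action) \<Rightarrow> real" where
  "next_age n \<sigma>I \<sigma>S \<sigma>C \<Delta> k a =
     (if transmitters n a = {} then \<Delta> k + \<sigma>I
      else if transmitters n a = {k} then \<sigma>S
      else if card (transmitters n a) = 1 then \<Delta> k + \<sigma>S
      else \<Delta> k + \<sigma>C)"

definition payoff ::
  "nat \<Rightarrow> real \<Rightarrow> real \<Rightarrow> real \<Rightarrow> (nat \<Rightarrow> real) \<Rightarrow> nat \<Rightarrow> (nat \<Rightarrow> action) \<Rightarrow> real" where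
  "payoff n \<sigma>I \<sigma>S \<sigma>C \<Delta> k a = - next_age n \<sigma>I \<sigma>S \<sigma>C \<Delta> k a"

text \<open>The profile \<open>b\<close> of the opponents of \<open>k\<close> is an extensional function on
  \<open>{1..n} - {k}\<close>; \<open>b(k := x)\<close> is the full profile in which \<open>k\<close> plays \<open>x\<close>.\<close>

definition minmax_payoff ::
  "nat \<Rightarrow> real \<Rightarrow> real \<Rightarrow> real \<Rightarrow> (nat \<Rightarrow> real) \<Rightarrow> nat \<Rightarrow> real" where
  "minmax_payoff n \<sigma>I \<sigma>S \<sigma>C \<Delta> k =
     Min ((\<lambda>b. Max ((\<lambda>x. payoff n \<sigma>I \<sigma>S \<sigma>C \<Delta> k (b(k := x))) ` {Transmit, Idle}))
          ` (({1..n} - {k}) \<rightarrow>\<^sub>E {Transmit, Idle}))"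

text \<open>A correlated strategy: \<open>p_succ p k\<close> is the probability that \<open>k\<close> is the only
  transmitter, \<open>p_idle p\<close> that nobody transmits, \<open>p_coll p\<close> that at least two sources do.
  Values of \<open>p_succ p\<close> outside \<open>{1..n}\<close> are irrelevant.\<close>

record strategy =
  p_succ :: "nat \<Rightarrow> real"
  p_idle :: real
  p_coll :: real

definition prob_vector :: "nat \<Rightarrow> strategy \<Rightarrow> bool" where
  "prob_vector n p \<longleftrightarrow>
     (\<forall>k\<in>{1..n}. p_succ p k \<ge> 0) \<and> p_idle p \<ge> 0 \<and> p_coll p \<ge> 0 \<and>
     (\<Sum>k\<in>{1..n}. p_succ p k) + p_idle p + p_coll p = 1"

definition expected_payoff ::
  "nat \<Rightarrow> real \<Rightarrow> real \<Rightarrow> real \<Rightarrow> (nat \<Rightarrow> real) \<Rightarrow> nat \<Rightarrow> strategy \<Rightarrow> real" where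
  "expected_payoff n \<sigma>I \<sigma>S \<sigma>C \<Delta> k p =
     - (p_succ p k * \<sigma>S
        + (\<Sum>j\<in>{1..n} - {k}. p_succ p j) * (\<Delta> k + \<sigma>S)
        + p_idle p * (\<Delta> k + \<sigma>I)
        + p_coll p * (\<Delta> k + \<sigma>C))"

definition individually_rational ::
  "nat \<Rightarrow> real \<Rightarrow> real \<Rightarrow> real \<Rightarrow> (nat \<Rightarrow> real) \<Rightarrow> strategy set" where
  "individually_rational n \<sigma>I \<sigma>S \<sigma>C \<Delta> =
     {p. prob_vector n p \<and>
         (\<forall>k\<in>{1..n}. expected_payoff n \<sigma>I \<sigma>S \<sigma>C \<Delta> k p \<ge> minmax_payoff n \<sigma>I \<sigma>S \<sigma>C \<Delta> k)}"

definition one_stage_optimal ::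
  "nat \<Rightarrow> real \<Rightarrow> real \<Rightarrow> real \<Rightarrow> (nat \<Rightarrow> real) \<Rightarrow> strategy \<Rightarrow> bool" where
  "one_stage_optimal n \<sigma>I \<sigma>S \<sigma>C \<Delta> p \<longleftrightarrow>
     is_arg_max (\<lambda>q. \<Sum>k\<in>{1..n}. expected_payoff n \<sigma>I \<sigma>S \<sigma>C \<Delta> k q)
       (\<lambda>q. q \<in> individually_rational n \<sigma>I \<sigma>S \<sigma>C \<Delta>) p"

end

(* Relative to the idle slot, a probability vector p changes the expected payoff of k by
   p_k Delta_k - (sum_j p_j)(sigma_S - sigma_I) - p_C (sigma_C - sigma_I).
   Hence moving the collision mass to the idle event strictly improves every source, which forces
   p_C = 0.  Never transmitting is individually rational, because a single transmitting opponent
   already holds k to something worse.  When p_C = 0 the sum over k of the gains over the idle slot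
   is sum_k p_k (Delta_k - n (sigma_S - sigma_I)), so if all the brackets are negative,
   optimality forces p_k = 0 for every k. *)

theory Submission
  imports Defs
begin

text \<open>Normalisation eliminates \<open>p_idle\<close>, which leaves the idle-slot payoff plus
  corrections. A success of \<open>k\<close> itself is an ordinary success slot that also erases the
  old age \<Delta> k.\<close>

lemma expected_payoff_conv_idle:
  assumes "prob_vector n p" "k \<in> {1..n}"
  shows "expected_payoff n \<sigma>I \<sigma>S \<sigma>C \<Delta> k p =
    - (\<Delta> k + \<sigma>I) + p_succ p k * \<Delta> k
    - (\<Sum>j\<in>{1..n}. p_succ p j) * (\<sigma>S - \<sigma>I) - p_coll p * (\<sigma>C - \<sigma>I)"
proof -
  define s where "s = (\<Sum>j\<in>{1..n}. p_succ p j)"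
  have rest: "(\<Sum>j\<in>{1..n} - {k}. p_succ p j) = s - p_succ p k"
    using assms(2) by (simp add: s_def sum_diff1)
  have idle: "p_idle p = 1 - s - p_coll p"
    using assms(1) by (simp add: prob_vector_def s_def)
  show ?thesis
    unfolding expected_payoff_def rest idle s_def[symmetric] by algebra
qed

text \<open>A success of \<open>k\<close> resets only the age of \<open>k\<close>, while all
  \<open>n\<close> sources pay for the longer slot; hence the weight \<Delta> k - n (\<sigma>S -
  \<sigma>I) on \<open>p_succ p k\<close>.\<close>

lemma sum_expected_payoff:
  assumes "prob_vector n p"
  shows "(\<Sum>k\<in>{1..n}. expected_payoff n \<sigma>I \<sigma>S \<sigma>C \<Delta> k p) =
    - (\<Sum>k\<in>{1..n}. \<Delta> k + \<sigma>I)
    + (\<Sum>k\<in>{1..n}. p_succ p k * (\<Delta> k - real n * (\<sigma>S - \<sigma>I)))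
    - real n * p_coll p * (\<sigma>C - \<sigma>I)"
proof -
  have "(\<Sum>k\<in>{1..n}. expected_payoff n \<sigma>I \<sigma>S \<sigma>C \<Delta> k p) =
    (\<Sum>k\<in>{1..n}. - (\<Delta> k + \<sigma>I) + p_succ p k * \<Delta> k
      - (\<Sum>j\<in>{1..n}. p_succ p j) * (\<sigma>S - \<sigma>I) - p_coll p * (\<sigma>C - \<sigma>I))"
    using expected_payoff_conv_idle[OF assms] by (intro sum.cong) auto
  also have "\<dots> = - (\<Sum>k\<in>{1..n}. \<Delta> k + \<sigma>I) + (\<Sum>k\<in>{1..n}. p_succ p k * \<Delta> k)
      - real n * ((\<Sum>j\<in>{1..n}. p_succ p j) * (\<sigma>S - \<sigma>I)) - real n * (p_coll p * (\<sigma>C - \<sigma>I))"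
    unfolding sum_subtractf sum.distrib sum_negf by simp
  also have "real n * ((\<Sum>j\<in>{1..n}. p_succ p j) * (\<sigma>S - \<sigma>I)) =
      (\<Sum>k\<in>{1..n}. p_succ p k * (real n * (\<sigma>S - \<sigma>I)))"
    unfolding sum_distrib_right[symmetric] by (simp add: algebra_simps)
  finally show ?thesis
    unfolding right_diff_distrib[of "p_succ p _" "\<Delta> _"] sum_subtractf by simp
qed

text \<open>One punishing profile bounds the minimum: a single opponent \<open>m\<close> transmits,
  and it exists since n \<ge> 2.\<close>

lemma minmax_payoff_le_idle:
  assumes "n \<ge> 2" "k \<in> {1..n}" "\<sigma>I \<le> \<sigma>S" "\<sigma>I \<le> \<sigma>C"
  shows "minmax_payoff n \<sigma>I \<sigma>S \<sigma>C \<Delta> k \<le> - (\<Delta> k + \<sigma>I)"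
proof -
  obtain m where m: "m \<in> {1..n}" "m \<noteq> k"
    using assms(1) that[of "if k = 1 then 2 else 1"] by (auto split: if_splits)
  define b where "b = (\<lambda>j\<in>{1..n} - {k}. if j = m then Transmit else Idle)"
  have b: "b \<in> ({1..n} - {k}) \<rightarrow>\<^sub>E {Transmit, Idle}"
    by (auto simp: b_def)
  have "payoff n \<sigma>I \<sigma>S \<sigma>C \<Delta> k (b(k := x)) \<le> - (\<Delta> k + \<sigma>I)" for x
  proof -
    have "m \<in> transmitters n (b(k := x))"
      using m by (simp add: transmitters_def b_def)
    \<comment> \<open>Only the last two branches of \<open>next_age\<close> remain: success of
      \<open>m\<close> if \<open>k\<close> idles, collision if \<open>k\<close> transmits. Neither
      slot is shorter than an idle one.\<close>
    then have "transmitters n (b(k := x)) \<noteq> {}" "transmitters n (b(k := x)) \<noteq> {k}"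
      using m by auto
    then show ?thesis
      using assms(3,4) by (simp add: payoff_def next_age_def)
  qed
  then have "Max ((\<lambda>x. payoff n \<sigma>I \<sigma>S \<sigma>C \<Delta> k (b(k := x))) ` {Transmit, Idle}) \<le> - (\<Delta> k + \<sigma>I)"
    by simp
  moreover have "finite (({1..n} - {k}) \<rightarrow>\<^sub>E {Transmit, Idle})"
    by (intro finite_PiE) auto
  ultimately show ?thesis
    unfolding minmax_payoff_def using b by (intro Min_le_iff[THEN iffD2]) auto
qed

lemma one_stage_optimalD:
  assumes "one_stage_optimal n \<sigma>I \<sigma>S \<sigma>C \<Delta> p"
  shows "p \<in> individually_rational n \<sigma>I \<sigma>S \<sigma>C \<Delta>"
    and "q \<in> individually_rational n \<sigma>I \<sigma>S \<sigma>C \<Delta> \<Longrightarrow>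
      (\<Sum>k\<in>{1..n}. expected_payoff n \<sigma>I \<sigma>S \<sigma>C \<Delta> k q)
      \<le> (\<Sum>k\<in>{1..n}. expected_payoff n \<sigma>I \<sigma>S \<sigma>C \<Delta> k p)"
  using assms by (auto simp: one_stage_optimal_def is_arg_max_linorder)

lemma one_stage_optimal_coll:
  assumes "n > 0" "\<sigma>I < \<sigma>C" and opt: "one_stage_optimal n \<sigma>I \<sigma>S \<sigma>C \<Delta> p"
  shows "p_coll p = 0"
proof -
  define q where "q = p\<lparr>p_idle := p_idle p + p_coll p, p_coll := 0\<rparr>"
  have p: "prob_vector n p" "p_coll p \<ge> 0"
    and p_ir: "\<And>k. k \<in> {1..n} \<Longrightarrow>
      minmax_payoff n \<sigma>I \<sigma>S \<sigma>C \<Delta> k \<le> expected_payoff n \<sigma>I \<sigma>S \<sigma>C \<Delta> k p"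
    using one_stage_optimalD(1)[OF opt] by (auto simp: individually_rational_def prob_vector_def)
  have q: "prob_vector n q"
    using p by (auto simp: q_def prob_vector_def)
  \<comment> \<open>Success probabilities are unchanged, so the gain is the same for all sources; it
    preserves individual rationality and adds up to \<open>n\<close> times itself in the
    objective.\<close>
  have gain: "expected_payoff n \<sigma>I \<sigma>S \<sigma>C \<Delta> k q =
      expected_payoff n \<sigma>I \<sigma>S \<sigma>C \<Delta> k p + p_coll p * (\<sigma>C - \<sigma>I)" for k
    by (simp add: expected_payoff_def q_def algebra_simps)
  have nonneg: "0 \<le> p_coll p * (\<sigma>C - \<sigma>I)"
    using p(2) assms(2) by simp
  have "minmax_payoff n \<sigma>I \<sigma>S \<sigma>C \<Delta> k \<le> expected_payoff n \<sigma>I \<sigma>S \<sigma>C \<Delta> k q"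
    if "k \<in> {1..n}" for k
    using p_ir[OF that] nonneg unfolding gain by linarith
  with q have "q \<in> individually_rational n \<sigma>I \<sigma>S \<sigma>C \<Delta>"
    by (simp add: individually_rational_def)
  from one_stage_optimalD(2)[OF opt this]
  have "real n * (p_coll p * (\<sigma>C - \<sigma>I)) \<le> 0"
    unfolding gain sum.distrib by simp
  with p(2) assms(1,2) show ?thesis
    by (auto simp: mult_le_0_iff)
qed

text \<open>Supplies the feasible competitor for the comparison with an optimum.\<close>

lemma idle_individually_rational:
  assumes "n \<ge> 2" "\<sigma>I \<le> \<sigma>S" "\<sigma>I \<le> \<sigma>C"
  shows "\<lparr>p_succ = \<lambda>_. 0, p_idle = 1, p_coll = 0\<rparr> \<in> individually_rational n \<sigma>I \<sigma>S \<sigma>C \<Delta>"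
  using minmax_payoff_le_idle[OF assms(1) _ assms(2,3)]
  by (auto simp: individually_rational_def prob_vector_def expected_payoff_def)

lemma one_stage_optimal_idle:
  assumes "n \<ge> 2" "\<sigma>I \<le> \<sigma>S" "\<sigma>I < \<sigma>C"
    and opt: "one_stage_optimal n \<sigma>I \<sigma>S \<sigma>C \<Delta> p"
    and small: "\<And>k. k \<in> {1..n} \<Longrightarrow> \<Delta> k < real n * (\<sigma>S - \<sigma>I)"
  shows "p_idle p = 1"
proof -
  define w where "w = (\<lambda>k. p_succ p k * (\<Delta> k - real n * (\<sigma>S - \<sigma>I)))"
  define e where "e = \<lparr>p_succ = \<lambda>_. 0 :: real, p_idle = 1, p_coll = 0 :: real\<rparr>"
  have p: "prob_vector n p"
    using one_stage_optimalD(1)[OF opt] by (simp add: individually_rational_def)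
  have coll: "p_coll p = 0"
    using one_stage_optimal_coll[OF _ assms(3) opt] assms(1) by simp
  have e_ir: "e \<in> individually_rational n \<sigma>I \<sigma>S \<sigma>C \<Delta>"
    unfolding e_def using assms(1-3) by (intro idle_individually_rational) auto
  have "prob_vector n e"
    using e_ir by (simp add: individually_rational_def)
  \<comment> \<open>In both sums the idle constant is the same and the collision term vanishes; for
    \<open>e\<close> the weighted sum is 0 as well.\<close>
  from one_stage_optimalD(2)[OF opt e_ir]
  have "0 \<le> sum w {1..n}"
    unfolding sum_expected_payoff[OF p] sum_expected_payoff[OF \<open>prob_vector n e\<close>]
    by (simp add: coll e_def w_def)
  moreover have w: "w k \<le> 0" if "k \<in> {1..n}" for k
    using p small[OF that] that by (auto simp: w_def prob_vector_def intro!: mult_nonneg_nonpos)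
  ultimately have "sum w {1..n} = 0"
    using sum_nonpos[of "{1..n}" w] by force
  then have "\<forall>k\<in>{1..n}. w k = 0"
    using sum_nonneg_eq_0_iff[of "{1..n}" "\<lambda>k. - w k"] w by (auto simp: sum_negf)
  \<comment> \<open>The strict bound \<open>small\<close> makes the second factor of
    \<open>w k\<close> nonzero.\<close>
  then have "\<forall>k\<in>{1..n}. p_succ p k = 0"
    using small by (force simp: w_def)
  with p coll show ?thesis
    by (simp add: prob_vector_def)
qed

theorem theorem1:
  fixes n :: nat
    and \<sigma>I \<sigma>S \<sigma>C :: real
    and \<Delta> :: "nat \<Rightarrow> real"
    and p :: strategy
  assumes "n \<ge> 2"
    and "\<sigma>I > 0" and "\<sigma>S > 0" and "\<sigma>C > 0"
    and "\<sigma>I < \<sigma>S" and "\<sigma>I < \<sigma>C"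
    and "\<And>k. k \<in> {1..n} \<Longrightarrow> \<Delta> k \<ge> \<sigma>S"
    and "one_stage_optimal n \<sigma>I \<sigma>S \<sigma>C \<Delta> p"
  shows "p_coll p = 0 \<and>
    ((\<forall>k\<in>{1..n}. \<Delta> k < real n * (\<sigma>S - \<sigma>I)) \<longrightarrow> p_idle p = 1)"
proof (intro conjI impI)
  show "p_coll p = 0"
    using one_stage_optimal_coll[OF _ \<open>\<sigma>I < \<sigma>C\<close> assms(8)] \<open>n \<ge> 2\<close> by simp
  show "p_idle p = 1" if "\<forall>k\<in>{1..n}. \<Delta> k < real n * (\<sigma>S - \<sigma>I)"
    using one_stage_optimal_idle[OF \<open>n \<ge> 2\<close> _ \<open>\<sigma>I < \<sigma>C\<close> assms(8)] \<open>\<sigma>I < \<sigma>S\<close> that by simp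
qed

end
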